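(* Consider the log-linearized general equilibrium system described in the context, with exogenous policy change $\hat s$, with $\sigma_R\neq 0$ and with $\sigma_X,\sigma_E$ not both zero. Define $$A\equiv 1-\gamma(1-\theta_{XR}),\quad B\equiv \theta_{RK}+\alpha_R\theta_{RQ},\quad C\equiv \alpha_X\theta_{ER}\sigma_X+(\alpha_F+\alpha_X\theta_{EF})\sigma_E,\quad D\equiv \frac{\theta_{RQ}}{\sigma_R}+\frac{AB}{C}.$$ Then the solution of the system satisfies $$\hat R=\theta_{RK}\hat K_R=\left(\frac{\gamma\theta_{RK}}{D}\right)\hat s,$$ $$\hat F=\hat K_F=\left[1-\sigma_E\left(\frac{B}{\theta_{RK}C}\right)\right]\hat R,$$ $$\hat E=\left[1-\sigma_E\left(\frac{B}{\theta_{RK}C}\right)\theta_{EF}\right]\hat R,$$ $$\hat K_X=\left(\frac{-1}{\alpha_X\theta_{RK}}\right)\left[\alpha_R+\alpha_F\theta_{RK}\left(1-\sigma_E\left(\frac{B}{\theta_{RK}C}\right)\right)\right]\hat R,$$ $$\hat X=\left[\theta_{XE}-\left(\frac{\alpha_R+\alpha_F\theta_{RK}}{\alpha_X\theta_{RK}}\right)\theta_{XK}\right]\hat R=-\left(\frac{sR}{I}\right)\hat R,$$ and the proportional change in emissions $\hat Z=\rho_F\hat F+\rho_X\hat K_X$ equals $$\hat Z=\rho_F\left[1-\sigma_E\left(\frac{B}{\theta_{RK}C}\right)\right]\hat R+\rho_X\left(\frac{-1}{\alpha_X\theta_{RK}}\right)\left[\alpha_R+\alpha_F\theta_{RK}\left(1-\sigma_E\left(\frac{B}{\theta_{RK}C}\right)\right)\right]\hat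 R.$$ In particular, $\hat R>0$ when $\hat s>0$.
   Context: Initial equilibrium. The following level values are positive reals: capital uses $K_X,K_R,K_F$ with $\bar K=K_X+K_R+K_F$; a fixed factor $\bar Q$; quantities $X$ (final good), $E$ (energy), $R$ (renewable energy), $F$ (fossil energy, $F=K_F$); prices $P_X=1,P_E,P_R,P_F,P_K,P_Q$; an ad valorem capital tax $t$ and a per-unit offset payment $s$. They satisfy the zero-profit conditions $P_XX=(1+t)P_KK_X+P_EE$, $P_EE=P_FF+P_RR$, $(P_R+s)R=(1+t)P_KK_R+P_Q\bar Q$, $P_FF=(1+t)P_KK_F$, and the balanced government budget $tP_K\bar K=sR$. Total income is $I=P_XX$. Share parameters: $\alpha_i=K_i/\bar K$ for $i\in\{X,R,F\}$; $\theta_{XK}=\frac{(1+t)P_KK_X}{P_XX}$, $\theta_{XE}=\frac{P_EE}{P_XX}$, $\theta_{EF}=\frac{P_FF}{P_EE}$, $\theta_{ER}=\frac{P_RR}{P_EE}$, $\theta_{XF}=\theta_{XE}\theta_{EF}$, $\theta_{XR}=\theta_{XE}\theta_{ER}$, $\theta_{RK}=\frac{(1+t)P_KK_R}{(P_R+s)R}$, $\theta_{RQ}=\frac{P_Q\bar Q}{(P_R+s)R}$, $\gamma=\frac{s}{P_R+s}$, $\psi=\frac{1+t}{t}$. Elasticities of substitution $\sigma_X,\sigma_E,\sigma_R\ge 0$ are given parameters. Log-linear system. Hatted variables denote small proportional changes and are the real unknowns of a linear system ($\hat t=dt/(1+t)$, $\hat s=ds/s$). Given exogenous $\hat s$, the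 14 unknowns $\hat K_X,\hat K_R,\hat K_F,\hat X,\hat E,\hat F,\hat R,\hat P_K,\hat P_X,\hat P_E,\hat P_F,\hat P_R,\hat P_Q,\hat t$ solve the 14 equations: $0=\alpha_X\hat K_X+\alpha_R\hat K_R+\alpha_F\hat K_F$; $\hat X=\theta_{XK}\hat K_X+\theta_{XE}\hat E$; $\hat P_X+\hat X=\theta_{XK}(\hat t+\hat P_K+\hat K_X)+\theta_{XE}(\hat P_E+\hat E)$; $\hat K_X-\hat E=\sigma_X(\hat P_E-\hat t-\hat P_K)$; $\hat E=\theta_{EF}\hat F+\theta_{ER}\hat R$; $\hat P_E+\hat E=\theta_{EF}(\hat P_F+\hat F)+\theta_{ER}(\hat P_R+\hat R)$; $\hat R-\hat F=\sigma_E(\hat P_F-\hat P_R)$; $\hat R=\theta_{RK}\hat K_R$; $(1-\gamma)\hat P_R+\gamma\hat s+\hat R=\theta_{RK}(\hat t+\hat P_K+\hat K_R)+\theta_{RQ}\hat P_Q$; $\hat K_R=\sigma_R(\hat P_Q-\hat t-\hat P_K)$; $\hat F=\hat K_F$; $\hat P_F+\hat F=\hat t+\hat P_K+\hat K_F$; $\hat s+\hat R=\psi\hat t+\hat P_K$; $\hat P_X=0$. Emissions: with emission factors $\xi_F,\xi_X\ge0$ and $Z=\xi_FF+\xi_XK_X>0$, set $\rho_F=\xi_FF/Z$ and $\rho_X=\xi_XK_X/Z$, so $\rho_F+\rho_X=1$; the proportional change in emissions is $\hat Z=\rho_F\hat F+\rho_X\hat K_X$. *)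

theory Defs
  imports Complex_Main
begin

record levels =
  K_X :: real
  K_R :: real
  K_F :: real
  Q_bar :: real
  qty_X :: real
  qty_E :: real
  qty_R :: real
  qty_F :: real
  P_X :: real
  P_E :: real
  P_R :: real
  P_F :: real
  P_K :: real
  P_Q :: real
  tax :: real
  subsidy :: real \<comment> \<open>the per-unit offset payment \<open>s\<close>\<close>

definition K_bar :: "levels \<Rightarrow> real" where
  "K_bar e = K_X e + K_R e + K_F e"

definition income :: "levels \<Rightarrow> real" where
  "income e = P_X e * qty_X e"

definition positive_levels :: "levels \<Rightarrow> bool" where
  "positive_levels e \<longleftrightarrow>
     K_X e > 0 \<and> K_R e > 0 \<and> K_F e > 0 \<and> Q_bar e > 0 \<and>
     qty_X e > 0 \<and> qty_E e > 0 \<and> qty_R e > 0 \<and> qty_F e > 0 \<and>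
     P_X e > 0 \<and> P_E e > 0 \<and> P_R e > 0 \<and> P_F e > 0 \<and> P_K e > 0 \<and> P_Q e > 0 \<and>
     tax e > 0 \<and> subsidy e > 0"

definition initial_equilibrium :: "levels \<Rightarrow> bool" where
  "initial_equilibrium e \<longleftrightarrow>
     positive_levels e \<and>
     P_X e = 1 \<and>
     qty_F e = K_F e \<and>
     P_X e * qty_X e = (1 + tax e) * P_K e * K_X e + P_E e * qty_E e \<and>
     P_E e * qty_E e = P_F e * qty_F e + P_R e * qty_R e \<and>
     (P_R e + subsidy e) * qty_R e = (1 + tax e) * P_K e * K_R e + P_Q e * Q_bar e \<and>
     P_F e * qty_F e = (1 + tax e) * P_K e * K_F e \<and>
     tax e * P_K e * K_bar e = subsidy e * qty_R e"

definition alpha_X :: "levels \<Rightarrow> real" where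
  "alpha_X e = K_X e / K_bar e"

definition alpha_R :: "levels \<Rightarrow> real" where
  "alpha_R e = K_R e / K_bar e"

definition alpha_F :: "levels \<Rightarrow> real" where
  "alpha_F e = K_F e / K_bar e"

definition theta_XK :: "levels \<Rightarrow> real" where
  "theta_XK e = (1 + tax e) * P_K e * K_X e / (P_X e * qty_X e)"

definition theta_XE :: "levels \<Rightarrow> real" where
  "theta_XE e = P_E e * qty_E e / (P_X e * qty_X e)"

definition theta_EF :: "levels \<Rightarrow> real" where
  "theta_EF e = P_F e * qty_F e / (P_E e * qty_E e)"

definition theta_ER :: "levels \<Rightarrow> real" where
  "theta_ER e = P_R e * qty_R e / (P_E e * qty_E e)"

definition theta_XF :: "levels \<Rightarrow> real" where
  "theta_XF e = theta_XE e * theta_EF e"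

definition theta_XR :: "levels \<Rightarrow> real" where
  "theta_XR e = theta_XE e * theta_ER e"

definition theta_RK :: "levels \<Rightarrow> real" where
  "theta_RK e = (1 + tax e) * P_K e * K_R e / ((P_R e + subsidy e) * qty_R e)"

definition theta_RQ :: "levels \<Rightarrow> real" where
  "theta_RQ e = P_Q e * Q_bar e / ((P_R e + subsidy e) * qty_R e)"

definition gamma :: "levels \<Rightarrow> real" where
  "gamma e = subsidy e / (P_R e + subsidy e)"

definition psi :: "levels \<Rightarrow> real" where
  "psi e = (1 + tax e) / tax e"

text \<open>
  The unknowns of the linear system.  All are proportional changes of the corresponding level,
  except that \<open>ht\<close> stands for \<open>dt / (1 + t)\<close>.
\<close>

record changes =
  hK_X :: real
  hK_R :: real
  hK_F :: real
  hX :: real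
  hE :: real
  hF :: real
  hR :: real
  hP_K :: real
  hP_X :: real
  hP_E :: real
  hP_F :: real
  hP_R :: real
  hP_Q :: real
  ht :: real

definition solves_loglinear_system ::
  "levels \<Rightarrow> real \<Rightarrow> real \<Rightarrow> real \<Rightarrow> real \<Rightarrow> changes \<Rightarrow> bool" where
  "solves_loglinear_system e \<sigma>X \<sigma>E \<sigma>R hs h \<longleftrightarrow>
     0 = alpha_X e * hK_X h + alpha_R e * hK_R h + alpha_F e * hK_F h \<and>
     hX h = theta_XK e * hK_X h + theta_XE e * hE h \<and>
     hP_X h + hX h
       = theta_XK e * (ht h + hP_K h + hK_X h) + theta_XE e * (hP_E h + hE h) \<and>
     hK_X h - hE h = \<sigma>X * (hP_E h - ht h - hP_K h) \<and>
     hE h = theta_EF e * hF h + theta_ER e * hR h \<and>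
     hP_E h + hE h = theta_EF e * (hP_F h + hF h) + theta_ER e * (hP_R h + hR h) \<and>
     hR h - hF h = \<sigma>E * (hP_F h - hP_R h) \<and>
     hR h = theta_RK e * hK_R h \<and>
     (1 - gamma e) * hP_R h + gamma e * hs + hR h
       = theta_RK e * (ht h + hP_K h + hK_R h) + theta_RQ e * hP_Q h \<and>
     hK_R h = \<sigma>R * (hP_Q h - ht h - hP_K h) \<and>
     hF h = hK_F h \<and>
     hP_F h + hF h = ht h + hP_K h + hK_F h \<and>
     hs + hR h = psi e * ht h + hP_K h \<and>
     hP_X h = 0"

definition emissions :: "real \<Rightarrow> real \<Rightarrow> levels \<Rightarrow> real" where
  "emissions \<xi>F \<xi>X e = \<xi>F * qty_F e + \<xi>X * K_X e"

definition rho_F :: "real \<Rightarrow> real \<Rightarrow> levels \<Rightarrow> real" where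
  "rho_F \<xi>F \<xi>X e = \<xi>F * qty_F e / emissions \<xi>F \<xi>X e"

definition rho_X :: "real \<Rightarrow> real \<Rightarrow> levels \<Rightarrow> real" where
  "rho_X \<xi>F \<xi>X e = \<xi>X * K_X e / emissions \<xi>F \<xi>X e"

definition hZ :: "real \<Rightarrow> real \<Rightarrow> levels \<Rightarrow> changes \<Rightarrow> real" where
  "hZ \<xi>F \<xi>X e h = rho_F \<xi>F \<xi>X e * hF h + rho_X \<xi>F \<xi>X e * hK_X h"

end

theory Submission imports Defs begin

text \<open>
  Writing $r = \hat R$ and $d = \hat P_R - (\hat t + \hat P_K)$ for the price of renewable energy
  relative to the gross price of capital, every unknown of the system is an explicit affine
  function of $r$, $d$ and $\hat s$, and only two equations remain: capital market clearing,
  $B r + \theta_{RK} C d = 0$, and zero profit in renewable energy,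
  $A d + \gamma \hat s = \theta_{RQ} r / (\theta_{RK} \sigma_R)$.  Their determinant is a positive
  multiple of $D$.
\<close>

section \<open>Shares in the initial equilibrium\<close>

text \<open>Each sum of cost shares is a zero-profit condition divided by its revenue. The bounds on
  \<open>gamma e\<close> and \<open>theta_XR e\<close> later make A positive, and
  \<open>psi e > 1\<close> permits division by \<open>psi e - 1\<close>.\<close>

lemma initial_equilibriumD:
  assumes "initial_equilibrium e"
  shows alpha_pos: "alpha_X e > 0" "alpha_R e > 0" "alpha_F e > 0"
    and alpha_sum: "alpha_X e + alpha_R e + alpha_F e = 1"
    and theta_X_sum: "theta_XK e + theta_XE e = 1"
    and theta_E_pos: "theta_EF e > 0" "theta_ER e > 0"
    and theta_E_sum: "theta_EF e + theta_ER e = 1"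
    and theta_R_pos: "theta_RK e > 0" "theta_RQ e > 0"
    and theta_R_sum: "theta_RK e + theta_RQ e = 1"
    and theta_XR_pos: "theta_XR e > 0"
    and gamma_bounds: "gamma e > 0" "gamma e < 1"
    and psi_gt_1: "psi e > 1"
proof -
  have pos: "K_X e > 0" "K_R e > 0" "K_F e > 0" "Q_bar e > 0"
    "qty_X e > 0" "qty_E e > 0" "qty_R e > 0" "qty_F e > 0"
    "P_X e > 0" "P_E e > 0" "P_R e > 0" "P_F e > 0" "P_K e > 0" "P_Q e > 0"
    "tax e > 0" "subsidy e > 0"
    and X: "P_X e * qty_X e = (1 + tax e) * P_K e * K_X e + P_E e * qty_E e"
    and E: "P_E e * qty_E e = P_F e * qty_F e + P_R e * qty_R e"
    and R: "(P_R e + subsidy e) * qty_R e = (1 + tax e) * P_K e * K_R e + P_Q e * Q_bar e"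
    using assms unfolding initial_equilibrium_def positive_levels_def by auto
  have Kbar: "K_bar e > 0" using pos by (simp add: K_bar_def)
  show "alpha_X e > 0" "alpha_R e > 0" "alpha_F e > 0"
    using pos Kbar by (simp_all add: alpha_X_def alpha_R_def alpha_F_def)
  have "alpha_X e + alpha_R e + alpha_F e = K_bar e / K_bar e"
    by (simp only: alpha_X_def alpha_R_def alpha_F_def K_bar_def add_divide_distrib)
  then show "alpha_X e + alpha_R e + alpha_F e = 1" using Kbar by simp
  have I: "P_X e * qty_X e \<noteq> 0" and PE: "P_E e * qty_E e \<noteq> 0"
    and PR: "(P_R e + subsidy e) * qty_R e \<noteq> 0"
    using pos by simp_all
  show "theta_XK e + theta_XE e = 1"
    unfolding theta_XK_def theta_XE_def add_divide_distrib[symmetric] X[symmetric]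
    by (rule divide_self[OF I])
  show "theta_EF e > 0" "theta_ER e > 0"
    using pos by (simp_all add: theta_EF_def theta_ER_def)
  show "theta_EF e + theta_ER e = 1"
    unfolding theta_EF_def theta_ER_def add_divide_distrib[symmetric] E[symmetric]
    by (rule divide_self[OF PE])
  show "theta_RK e > 0" "theta_RQ e > 0"
    using pos by (simp_all add: theta_RK_def theta_RQ_def)
  show "theta_RK e + theta_RQ e = 1"
    unfolding theta_RK_def theta_RQ_def add_divide_distrib[symmetric] R[symmetric]
    by (rule divide_self[OF PR])
  show "theta_XR e > 0"
    using pos by (simp add: theta_XR_def theta_XE_def theta_ER_def)
  show "gamma e > 0" "gamma e < 1" "psi e > 1"
    using pos by (simp_all add: gamma_def psi_def)
qed

text \<open>Fossil energy is made from capital alone, so its zero-profit condition turns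
  \<open>theta_XE e * theta_EF e\<close> into gross capital cost in F over income. Both sides then
  equal (1 + t) P_K K_X K_F over income times \<open>K_bar e\<close>.\<close>

lemma theta_XK_alpha_F:
  assumes "initial_equilibrium e"
  shows "theta_XK e * alpha_F e = theta_XE e * theta_EF e * alpha_X e"
proof -
  have "P_E e > 0" "qty_E e > 0" and F: "P_F e * qty_F e = (1 + tax e) * P_K e * K_F e"
    using assms unfolding initial_equilibrium_def positive_levels_def by blast+
  then have "theta_XE e * theta_EF e = (1 + tax e) * P_K e * K_F e / (P_X e * qty_X e)"
    unfolding theta_XE_def theta_EF_def F[symmetric] by simp
  then show ?thesis by (simp add: theta_XK_def alpha_F_def alpha_X_def)
qed

text \<open>The bracket is the gross revenue (P_R + s) R of the renewable sector relative to income,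
  and \<open>theta_RK e\<close> is the part of it paid to capital. This is how the offset payments
  sR / I enter the formula for \<open>hX\<close>.\<close>

lemma theta_XK_alpha_R:
  assumes "initial_equilibrium e"
  shows "theta_XK e * alpha_R e
    = alpha_X e * theta_RK e * (theta_XR e + subsidy e * qty_R e / income e)"
proof -
  have pos: "P_E e > 0" "qty_E e > 0" "P_R e > 0" "subsidy e > 0" "qty_R e > 0"
    using assms unfolding initial_equilibrium_def positive_levels_def by blast+
  have "theta_XR e = P_R e * qty_R e / income e"
    using pos by (simp add: theta_XR_def theta_XE_def theta_ER_def income_def)
  then have "theta_XR e + subsidy e * qty_R e / income e
      = ((P_R e + subsidy e) * qty_R e) / income e"
    by (simp add: add_divide_distrib distrib_right)
  then have "theta_RK e * (theta_XR e + subsidy e * qty_R e / income e)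
      = (1 + tax e) * P_K e * K_R e / income e"
    using pos by (simp add: theta_RK_def)
  then show ?thesis
    by (simp add: theta_XK_def alpha_R_def alpha_X_def income_def mult.assoc)
qed

section \<open>Reduction to two equations in two unknowns\<close>

text \<open>
  Here \<open>- theta_XR e * d\<close> is the value of $\hat t + \hat P_K$, and
  \<open>(hs + r + theta_XR e * d) / (psi e - 1)\<close> that of $\hat t$, which the budget equation
  separates from $\hat P_K$.
\<close>

definition reduced_changes ::
  "levels \<Rightarrow> real \<Rightarrow> real \<Rightarrow> real \<Rightarrow> real \<Rightarrow> real \<Rightarrow> real \<Rightarrow> changes" where
  "reduced_changes e \<sigma>X \<sigma>E \<sigma>R hs r d =
    \<lparr> hK_X = r + (theta_EF e * \<sigma>E + theta_ER e * \<sigma>X) * d,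
      hK_R = r / theta_RK e,
      hK_F = r + \<sigma>E * d,
      hX = r + (theta_EF e * \<sigma>E + theta_XK e * theta_ER e * \<sigma>X) * d,
      hE = r + theta_EF e * \<sigma>E * d,
      hF = r + \<sigma>E * d,
      hR = r,
      hP_K = - theta_XR e * d - (hs + r + theta_XR e * d) / (psi e - 1),
      hP_X = 0,
      hP_E = - theta_XR e * d + theta_ER e * d,
      hP_F = - theta_XR e * d,
      hP_R = - theta_XR e * d + d,
      hP_Q = - theta_XR e * d + r / (theta_RK e * \<sigma>R),
      ht = (hs + r + theta_XR e * d) / (psi e - 1) \<rparr>"

text \<open>The coefficients are A, B and C of the theorem written out in shares. The first equation
  is capital market clearing multiplied by \<open>theta_RK e\<close>.\<close>

definition reduced_system ::
  "levels \<Rightarrow> real \<Rightarrow> real \<Rightarrow> real \<Rightarrow> real \<Rightarrow> real \<Rightarrow> real \<Rightarrow> bool" where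
  "reduced_system e \<sigma>X \<sigma>E \<sigma>R hs r d \<longleftrightarrow>
    (theta_RK e + alpha_R e * theta_RQ e) * r
      + theta_RK e * (alpha_X e * theta_ER e * \<sigma>X
          + (alpha_F e + alpha_X e * theta_EF e) * \<sigma>E) * d = 0 \<and>
    (1 - gamma e * (1 - theta_XR e)) * d + gamma e * hs = theta_RQ e * r / (theta_RK e * \<sigma>R)"

text \<open>The coefficient of \<open>r\<close> is
  \<open>theta_RK e * (1 - alpha_R e) + alpha_R e\<close>, which is B since
  \<open>theta_RK e + theta_RQ e = 1\<close>. The identity serves both directions of the
  reduction.\<close>

lemma capital_market_reduced:
  assumes "initial_equilibrium e"
  shows "theta_RK e * (alpha_X e * (r + (theta_EF e * \<sigma>E + theta_ER e * \<sigma>X) * d)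
      + alpha_R e * (r / theta_RK e) + alpha_F e * (r + \<sigma>E * d))
    = (theta_RK e + alpha_R e * theta_RQ e) * r
      + theta_RK e * (alpha_X e * theta_ER e * \<sigma>X
          + (alpha_F e + alpha_X e * theta_EF e) * \<sigma>E) * d"
proof -
  define k where "k = r / theta_RK e"
  have r: "r = theta_RK e * k" using theta_R_pos[OF assms] by (simp add: k_def)
  have shares: "alpha_F e = 1 - alpha_X e - alpha_R e" "theta_RQ e = 1 - theta_RK e"
    using alpha_sum[OF assms] theta_R_sum[OF assms] by simp_all
  show ?thesis unfolding k_def[symmetric] by (simp add: shares r algebra_simps)
qed

text \<open>Twelve of the fourteen equations hold for every \<open>r\<close> and \<open>d\<close>;
  the other two, capital market clearing and zero profit in R, are the reduced system.\<close>

lemma reduced_changes_solve: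
  assumes eq: "initial_equilibrium e" and "\<sigma>R \<noteq> 0"
    and red: "reduced_system e \<sigma>X \<sigma>E \<sigma>R hs r d"
  shows "solves_loglinear_system e \<sigma>X \<sigma>E \<sigma>R hs (reduced_changes e \<sigma>X \<sigma>E \<sigma>R hs r d)"
proof -
  define k where "k = r / theta_RK e"
  define t where "t = (hs + r + theta_XR e * d) / (psi e - 1)"
  define q where "q = r / (theta_RK e * \<sigma>R)"
  have t: "psi e * t = hs + r + theta_XR e * d + t"
    using psi_gt_1[OF eq] by (simp add: t_def field_simps)
  have k: "theta_RK e * k = r" and q: "\<sigma>R * q = k"
    using theta_R_pos[OF eq] \<open>\<sigma>R \<noteq> 0\<close> by (simp_all add: k_def q_def)
  have clear: "alpha_X e * (r + (theta_EF e * \<sigma>E + theta_ER e * \<sigma>X) * d)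
      + alpha_R e * k + alpha_F e * (r + \<sigma>E * d) = 0"
    using capital_market_reduced[OF eq, of r \<sigma>E \<sigma>X d] theta_R_pos[OF eq] red
    by (simp add: k_def reduced_system_def)
  have profit: "(1 - gamma e * (1 - theta_XR e)) * d + gamma e * hs = theta_RQ e * q"
    using red by (simp add: reduced_system_def q_def)
  have shares: "theta_XK e = 1 - theta_XE e" "theta_EF e = 1 - theta_ER e"
    "theta_RQ e = 1 - theta_RK e"
    using theta_X_sum[OF eq] theta_E_sum[OF eq] theta_R_sum[OF eq] by simp_all
  \<comment> \<open>Since \<open>theta_RK e * k = r\<close>, the quantity terms cancel. The
    coefficient of \<open>d\<close> becomes (1 - \<gamma>)(1 - \<theta>) + \<theta> = 1 - \<gamma>
    (1 - \<theta>) with \<theta> = \<open>theta_XR e\<close>, so this is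
    \<open>profit\<close>.\<close>
  have 9: "(1 - gamma e) * (- theta_XR e * d + d) + gamma e * hs + r
      = theta_RK e * (- theta_XR e * d + k) + theta_RQ e * (- theta_XR e * d + q)"
    using profit k by (simp add: shares algebra_simps)
  show ?thesis
    unfolding solves_loglinear_system_def reduced_changes_def
      k_def[symmetric] t_def[symmetric] q_def[symmetric] changes.simps
    using clear t k q 9
    by (intro conjI) (simp_all add: shares theta_XR_def algebra_simps)
qed

text \<open>Subtracting each production equation from the zero-profit equation of the same sector
  leaves relations between prices alone. These express all prices through \<open>d\<close>, up to
  \<open>hs\<close> and \<open>r\<close>; the substitution elasticities then give the
  quantities.\<close>

lemma solution_reduced:
  assumes eq: "initial_equilibrium e" and "\<sigma>R \<noteq> 0"
    and sol: "solves_loglinear_system e \<sigma>X \<sigma>E \<sigma>R hs h"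
  obtains r d where "h = reduced_changes e \<sigma>X \<sigma>E \<sigma>R hs r d"
    and "reduced_system e \<sigma>X \<sigma>E \<sigma>R hs r d"
proof -
  define r where "r = hR h"
  define w where "w = ht h + hP_K h"
  define d where "d = hP_R h - w"
  note sys = sol[unfolded solves_loglinear_system_def]
  have shares: "theta_XK e = 1 - theta_XE e" "theta_EF e = 1 - theta_ER e"
    "theta_RQ e = 1 - theta_RK e"
    using theta_X_sum[OF eq] theta_E_sum[OF eq] theta_R_sum[OF eq] by simp_all
  have PF: "hP_F h = w" and F: "hF h = hK_F h" and PX: "hP_X h = 0"
    using sys by (simp_all add: w_def)
  have PR: "hP_R h = w + d" by (simp add: d_def)
  have "hP_E h = theta_EF e * hP_F h + theta_ER e * hP_R h"
    using sys by (simp add: algebra_simps)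
  then have PE: "hP_E h = w + theta_ER e * d"
    by (simp add: PF PR shares algebra_simps)
  \<comment> \<open>The final good is the numeraire, so its price equation has left side 0. This
    fixes the common level \<open>w\<close> of all prices.\<close>
  have "theta_XK e * w + theta_XE e * hP_E h = 0"
    using sys by (simp add: w_def algebra_simps)
  then have w: "w = - theta_XR e * d"
    by (simp add: PE shares theta_XR_def algebra_simps)
  have KF: "hK_F h = r + \<sigma>E * d"
    using sys by (simp add: PF PR r_def algebra_simps)
  have "hE h = theta_EF e * hK_F h + theta_ER e * r"
    using sys by (simp add: r_def)
  then have E: "hE h = r + theta_EF e * \<sigma>E * d"
    by (simp add: KF shares algebra_simps)
  have "hK_X h - hE h = \<sigma>X * (hP_E h - w)"
    using sys by (simp add: w_def algebra_simps)
  then have KX: "hK_X h = r + (theta_EF e * \<sigma>E + theta_ER e * \<sigma>X) * d"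
    by (simp add: E PE algebra_simps)
  have X: "hX h = r + (theta_EF e * \<sigma>E + theta_XK e * theta_ER e * \<sigma>X) * d"
    using sys by (simp add: KX E shares algebra_simps)
  have KR: "hK_R h = r / theta_RK e"
    using sys theta_R_pos[OF eq] by (simp add: r_def)
  have "hK_R h = \<sigma>R * (hP_Q h - w)"
    using sys by (simp add: w_def algebra_simps)
  then have PQ: "hP_Q h = w + r / (theta_RK e * \<sigma>R)"
    using KR \<open>\<sigma>R \<noteq> 0\<close> theta_R_pos[OF eq] by (simp add: field_simps)
  \<comment> \<open>The other equations involve \<open>ht h\<close> and \<open>hP_K h\<close> only
    through their sum \<open>w\<close>; the budget equation alone separates them.\<close>
  have "hs + r = psi e * ht h + (w - ht h)"
    using sys unfolding r_def w_def by linarith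
  then have "(psi e - 1) * ht h = hs + r + theta_XR e * d"
    by (simp add: w algebra_simps)
  then have t: "ht h = (hs + r + theta_XR e * d) / (psi e - 1)"
    using psi_gt_1[OF eq] by (simp add: field_simps)
  have PK: "hP_K h = - theta_XR e * d - (hs + r + theta_XR e * d) / (psi e - 1)"
    using t w by (simp add: w_def)
  have h: "h = reduced_changes e \<sigma>X \<sigma>E \<sigma>R hs r d"
    unfolding reduced_changes_def
    using KX KR KF X E F r_def[symmetric] PK PX PE PF PR PQ t w
    by (intro changes.equality) simp_all
  have "(1 - gamma e) * hP_R h + gamma e * hs = theta_RK e * w + theta_RQ e * hP_Q h"
    using sys by (simp add: w_def algebra_simps)
  then have profit:
    "(1 - gamma e * (1 - theta_XR e)) * d + gamma e * hs = theta_RQ e * r / (theta_RK e * \<sigma>R)"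
    unfolding PR PQ times_divide_eq_right[symmetric] by (simp add: w shares algebra_simps)
  have "alpha_X e * (r + (theta_EF e * \<sigma>E + theta_ER e * \<sigma>X) * d)
      + alpha_R e * (r / theta_RK e) + alpha_F e * (r + \<sigma>E * d) = 0"
    using sys unfolding KX KR KF by linarith
  then have "reduced_system e \<sigma>X \<sigma>E \<sigma>R hs r d"
    using capital_market_reduced[OF eq, of r \<sigma>E \<sigma>X d] profit
    by (simp add: reduced_system_def)
  with h show ?thesis by (rule that)
qed

section \<open>Solving the two-by-two system\<close>

text \<open>Eliminating \<open>d\<close> by the first equation turns the second into
  \<open>g * hs = D * r / k\<close>, and \<open>D\<close> is positive because all its ingredients
  are. Being an equivalence, it yields existence as well as uniqueness.\<close>

lemma two_by_two_system_iff:
  fixes a b c k l g \<sigma> hs r d :: real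
  assumes "a > 0" "b > 0" "c > 0" "k > 0" "l > 0" "\<sigma> > 0"
  shows "b * r + k * c * d = 0 \<and> a * d + g * hs = l * r / (k * \<sigma>) \<longleftrightarrow>
    r = g * k / (l / \<sigma> + a * b / c) * hs \<and> d = - (b / (k * c)) * r"
proof -
  define D where "D = l / \<sigma> + a * b / c"
  have D: "D > 0" using assms by (simp add: D_def add_pos_pos)
  have 1: "b * r + k * c * d = 0 \<longleftrightarrow> d = - (b / (k * c)) * r"
    using assms by (auto simp: field_simps)
  have 2: "a * d + g * hs = l * r / (k * \<sigma>) \<longleftrightarrow> r = g * k / D * hs"
    if d: "d = - (b / (k * c)) * r"
  proof -
    have "l * r / (k * \<sigma>) - a * d = D * r / k"
      using assms by (simp add: d D_def field_simps)
    then have "a * d + g * hs = l * r / (k * \<sigma>) \<longleftrightarrow> g * hs = D * r / k"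
      by linarith
    also have "\<dots> \<longleftrightarrow> r = g * k / D * hs"
      using D assms by (auto simp: field_simps)
    finally show ?thesis .
  qed
  show ?thesis unfolding D_def[symmetric] using 1 2 by blast
qed

section \<open>Existence, uniqueness and closed form of the solution\<close>

theorem mainTheorem1:
  fixes e :: levels
    and \<sigma>X \<sigma>E \<sigma>R hs \<xi>F \<xi>X :: real
    and A B C D :: real
  assumes "initial_equilibrium e"
    and "\<sigma>X \<ge> 0" and "\<sigma>E \<ge> 0" and "\<sigma>R \<ge> 0"
    and "\<sigma>R \<noteq> 0" and "\<not> (\<sigma>X = 0 \<and> \<sigma>E = 0)"
    and "\<xi>F \<ge> 0" and "\<xi>X \<ge> 0" and "emissions \<xi>F \<xi>X e > 0"
    and A_def: "A = 1 - gamma e * (1 - theta_XR e)"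
    and B_def: "B = theta_RK e + alpha_R e * theta_RQ e"
    and C_def: "C = alpha_X e * theta_ER e * \<sigma>X + (alpha_F e + alpha_X e * theta_EF e) * \<sigma>E"
    and D_def: "D = theta_RQ e / \<sigma>R + A * B / C"
  shows "(\<exists>!h. solves_loglinear_system e \<sigma>X \<sigma>E \<sigma>R hs h) \<and>
    (\<forall>h. solves_loglinear_system e \<sigma>X \<sigma>E \<sigma>R hs h \<longrightarrow>
       hR h = theta_RK e * hK_R h \<and>
       hR h = (gamma e * theta_RK e / D) * hs \<and>
       hF h = hK_F h \<and>
       hF h = (1 - \<sigma>E * (B / (theta_RK e * C))) * hR h \<and>
       hE h = (1 - \<sigma>E * (B / (theta_RK e * C)) * theta_EF e) * hR h \<and>
       hK_X h = (- 1 / (alpha_X e * theta_RK e))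
         * (alpha_R e + alpha_F e * theta_RK e * (1 - \<sigma>E * (B / (theta_RK e * C)))) * hR h \<and>
       hX h = (theta_XE e
         - ((alpha_R e + alpha_F e * theta_RK e) / (alpha_X e * theta_RK e)) * theta_XK e) * hR h \<and>
       hX h = - (subsidy e * qty_R e / income e) * hR h \<and>
       hZ \<xi>F \<xi>X e h = rho_F \<xi>F \<xi>X e * (1 - \<sigma>E * (B / (theta_RK e * C))) * hR h
         + rho_X \<xi>F \<xi>X e * (- 1 / (alpha_X e * theta_RK e))
           * (alpha_R e + alpha_F e * theta_RK e * (1 - \<sigma>E * (B / (theta_RK e * C)))) * hR h \<and>
       (hs > 0 \<longrightarrow> hR h > 0))"
proof -
  note eq = \<open>initial_equilibrium e\<close>
  note pos = alpha_pos[OF eq] theta_E_pos[OF eq] theta_R_pos[OF eq] theta_XR_pos[OF eq]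
    gamma_bounds[OF eq]
  have \<sigma>R: "\<sigma>R > 0" using assms by simp
  \<comment> \<open>In this form both summands are visibly positive.\<close>
  have "A = (1 - gamma e) + gamma e * theta_XR e" by (simp add: A_def algebra_simps)
  then have A: "A > 0" using pos by (simp add: add_pos_pos)
  have B: "B > 0" using pos by (simp add: B_def add_pos_pos)
  have "alpha_X e * theta_ER e > 0" "alpha_F e + alpha_X e * theta_EF e > 0"
    using pos by (simp_all add: add_pos_pos)
  then have C: "C > 0"
    using assms(2,3,6) unfolding C_def
    by (cases "\<sigma>X = 0") (auto intro: add_pos_nonneg)
  have D: "D > 0" using A B C \<sigma>R pos by (simp add: D_def add_pos_pos)
  define b where "b = B / (theta_RK e * C)"
  define r where "r = gamma e * theta_RK e / D * hs"
  have red: "reduced_system e \<sigma>X \<sigma>E \<sigma>R hs r' d' \<longleftrightarrow> r' = r \<and> d' = - b * r'" for r' d'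
    unfolding reduced_system_def r_def b_def D_def A_def[symmetric] B_def[symmetric] C_def[symmetric]
    by (rule two_by_two_system_iff) (use A B C \<sigma>R pos in simp_all)
  define s where "s = reduced_changes e \<sigma>X \<sigma>E \<sigma>R hs r (- b * r)"
  have sol: "solves_loglinear_system e \<sigma>X \<sigma>E \<sigma>R hs s"
    unfolding s_def by (rule reduced_changes_solve) (use eq \<sigma>R red in simp_all)
  \<comment> \<open>Every solution is the explicit \<open>s\<close>, so the formulas only have to be
    checked for \<open>s\<close>.\<close>
  have unique: "h = s" if "solves_loglinear_system e \<sigma>X \<sigma>E \<sigma>R hs h" for h
    using eq \<open>\<sigma>R \<noteq> 0\<close> that by (rule solution_reduced) (simp add: red s_def)
  note sys = sol[unfolded solves_loglinear_system_def]
  have R: "hR s = r" and F: "hF s = (1 - \<sigma>E * b) * r"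
    and E: "hE s = (1 - \<sigma>E * b * theta_EF e) * r"
    by (simp_all add: s_def reduced_changes_def algebra_simps)
  have KF: "hF s = hK_F s" and KR: "hR s = theta_RK e * hK_R s"
    using sys by simp_all
  \<comment> \<open>Capital market clearing gives \<open>hK_X s\<close> in the claimed form; the
    expression in \<open>reduced_changes\<close> would involve \<open>\<sigma>X\<close>.\<close>
  have "alpha_X e * hK_X s = - (alpha_R e * hK_R s + alpha_F e * hK_F s)"
    using sys by linarith
  moreover have "hK_R s = r / theta_RK e" using KR R pos by simp
  moreover have "hK_F s = (1 - \<sigma>E * b) * r" using F KF by simp
  ultimately have KX: "hK_X s = (- 1 / (alpha_X e * theta_RK e))
      * (alpha_R e + alpha_F e * theta_RK e * (1 - \<sigma>E * b)) * r"
    using pos by (simp add: field_simps)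
  text \<open>
    By \<open>theta_XK_alpha_F\<close> the terms in $\sigma_E$ of $\theta_{XK} \hat K_X$ and
    $\theta_{XE} \hat E$ cancel.
  \<close>
  have "alpha_X e * theta_RK e * hX s = alpha_X e * theta_RK e * (theta_XE e
      - ((alpha_R e + alpha_F e * theta_RK e) / (alpha_X e * theta_RK e)) * theta_XK e) * r"
  proof -
    have 1: "alpha_X e * theta_RK e * hK_X s
        = - (alpha_R e + alpha_F e * theta_RK e * (1 - \<sigma>E * b)) * r"
      using pos by (simp add: KX field_simps)
    have 2: "alpha_X e * theta_RK e * hX s
        = theta_XK e * (alpha_X e * theta_RK e * hK_X s) + alpha_X e * theta_RK e * theta_XE e * hE s"
      using sys by (simp add: algebra_simps)
    have "alpha_X e * theta_RK e * hX s
        = (alpha_X e * theta_RK e * theta_XE e - theta_XK e * (alpha_R e + alpha_F e * theta_RK e)) * r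
          + theta_RK e * \<sigma>E * b * r
            * (theta_XK e * alpha_F e - theta_XE e * theta_EF e * alpha_X e)"
      unfolding 2 1 E by (simp add: algebra_simps)
    also have "\<dots> = alpha_X e * theta_RK e * (theta_XE e
        - ((alpha_R e + alpha_F e * theta_RK e) / (alpha_X e * theta_RK e)) * theta_XK e) * r"
      unfolding theta_XK_alpha_F[OF eq] using pos by (simp add: field_simps)
    finally show ?thesis .
  qed
  then have X: "hX s = (theta_XE e
      - ((alpha_R e + alpha_F e * theta_RK e) / (alpha_X e * theta_RK e)) * theta_XK e) * r"
    using pos by (simp add: mult.assoc)
  \<comment> \<open>For the second form of \<open>hX\<close>, the capital bracket is split into its
    R and F parts. They add up to \<open>theta_XE e\<close> plus sR / I, so only the offset payments
    survive.\<close>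
  have "((alpha_R e + alpha_F e * theta_RK e) / (alpha_X e * theta_RK e)) * theta_XK e
      = (theta_XK e * alpha_R e + theta_RK e * (theta_XK e * alpha_F e)) / (alpha_X e * theta_RK e)"
    by (simp add: algebra_simps)
  also have "\<dots> = theta_XR e + subsidy e * qty_R e / income e + theta_XE e * theta_EF e"
    unfolding theta_XK_alpha_F[OF eq] theta_XK_alpha_R[OF eq]
    using pos by (simp add: add_divide_distrib)
  also have "\<dots> = theta_XE e * (theta_EF e + theta_ER e) + subsidy e * qty_R e / income e"
    by (simp add: theta_XR_def algebra_simps)
  finally have X': "hX s = - (subsidy e * qty_R e / income e) * r"
    by (simp add: X theta_E_sum[OF eq])
  have Z: "hZ \<xi>F \<xi>X e s = rho_F \<xi>F \<xi>X e * (1 - \<sigma>E * b) * r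
      + rho_X \<xi>F \<xi>X e * (- 1 / (alpha_X e * theta_RK e))
        * (alpha_R e + alpha_F e * theta_RK e * (1 - \<sigma>E * b)) * r"
    unfolding hZ_def F KX by (simp only: mult.assoc)
  have "hs > 0 \<longrightarrow> r > 0" using D pos by (simp add: r_def)
  then show ?thesis
    unfolding b_def[symmetric]
    using sol unique R KR KF F E KX X X' Z r_def by metis
qed

end
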